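(* Assume $\rho>\xi(1-\sigma)$ and set $\alpha=\frac{\rho-\xi(1-\sigma)}{\sigma\xi}$ and $\nu=\alpha^{-\sigma}\frac1\xi$. The function $v:\mathcal Q\to\mathbb R$, $$v(x)=\nu\,\frac{[\Gamma(x)]^{1-\sigma}}{1-\sigma},$$ is differentiable at every $x\in\mathcal Q$ and is a classical solution, on the set $\mathcal O$, of the HJB equation $$\rho v(x)=\langle x,\mathcal A^*Dv(x)\rangle_X+\sup_{u\in\left[\left(1-\frac A{\tilde A}\right)x^0,\,x^0\right]}\left[u\tilde A\,\delta_{-d}(Dv(x))+\frac{(x^0-u)^{1-\sigma}}{1-\sigma}\right].$$
   Context: Constants: $A>0$, $\delta\ge0$, $\tilde A=A-\delta>0$, $d>0$, $\rho>0$, $\sigma>0$ with $\sigma\neq1$. $\xi$ is the unique positive real root of $z=\tilde Ae^{-zd}$. $X=\mathbb R\times L^2(-d,0;\mathbb R)$ with elements $x=(x^0,x^1)$ and inner product $\langle x,z\rangle_X=x^0z^0+\langle x^1,z^1\rangle_{L^2}$. $D(\mathcal A^* )=\{(\psi^0,\psi^1)\in X:\psi^1\in W^{1,2}([-d,0];\mathbb R),\ \psi^0=\psi^1(0)\}$, $\mathcal A^*(\psi^0,\psi^1)=(0,\frac d{ds}\psi^1)$, and $\delta_{-d}(\psi^0,\psi^1)=\psi^1(-d)$ for $(\psi^0,\psi^1)\in D(\mathcal A^* )$. $\Gamma(x)=x^0+\int_{-d}^0e^{\xi s}x^1(s)\,ds$, $\mathcal Q=\{x\in X:\Gamma(x)>0\}$,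 and $$\mathcal O=\left\{x=(x^0,x^1)\in\mathcal Q:\ \Gamma(x)<x^0\,\frac{A}{\alpha\tilde A}\right\}.$$ Classical solution on the open set $\mathcal O$: $v\in C^1(\mathcal O)$ with $Dv\in C(\mathcal O;D(\mathcal A^* ))$ (graph norm), satisfying the equation at every $x\in\mathcal O$. For $\sigma>1$ the expression $0^{1-\sigma}/(1-\sigma)$ is $-\infty$. *)

theory Defs
  imports "HOL-Analysis.Analysis"
begin

section \<open>The Hilbert space of square-integrable functions on the real line modulo null sets\<close>

definition sq_integrable :: "(real \<Rightarrow> real) \<Rightarrow> bool" where
  "sq_integrable f \<longleftrightarrow> f \<in> borel_measurable lborel \<and> integrable lborel (\<lambda>t. (f t)\<^sup>2)"

definition L2_eq :: "(real \<Rightarrow> real) \<Rightarrow> (real \<Rightarrow> real) \<Rightarrow> bool" where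
  "L2_eq f g \<longleftrightarrow> sq_integrable f \<and> sq_integrable g \<and> (AE t in lborel. f t = g t)"

lemma sq_integrable_zero: "sq_integrable (\<lambda>_. 0)"
  by (simp add: sq_integrable_def)

lemma sq_integrable_mult:
  assumes "sq_integrable f" "sq_integrable g"
  shows "integrable lborel (\<lambda>t. f t * g t)"
proof (rule Bochner_Integration.integrable_bound)
  show "integrable lborel (\<lambda>t. (f t)\<^sup>2 + (g t)\<^sup>2)"
    using assms by (simp add: sq_integrable_def)
  show "(\<lambda>t. f t * g t) \<in> borel_measurable lborel"
    using assms by (auto simp: sq_integrable_def)
  have "\<bar>a * b\<bar> \<le> a\<^sup>2 + b\<^sup>2" for a b :: real
  proof -
    have "2 * \<bar>a\<bar> * \<bar>b\<bar> \<le> \<bar>a\<bar>\<^sup>2 + \<bar>b\<bar>\<^sup>2" by (rule sum_squares_bound)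
    moreover have "0 \<le> \<bar>a\<bar> * \<bar>b\<bar>" by simp
    ultimately show ?thesis unfolding abs_mult power2_abs by linarith
  qed
  then show "AE t in lborel. norm (f t * g t) \<le> norm ((f t)\<^sup>2 + (g t)\<^sup>2)"
    by simp
qed

lemma sq_integrable_add:
  assumes "sq_integrable f" "sq_integrable g"
  shows "sq_integrable (\<lambda>t. f t + g t)"
proof -
  have "integrable lborel (\<lambda>t. (f t)\<^sup>2 + (g t)\<^sup>2 + 2 * (f t * g t))"
    using assms sq_integrable_mult[OF assms] by (simp add: sq_integrable_def)
  then show ?thesis
    using assms by (auto simp: sq_integrable_def power2_sum mult.assoc)
qed

lemma sq_integrable_scale:
  assumes "sq_integrable f"
  shows "sq_integrable (\<lambda>t. c * f t)"
  using assms by (auto simp: sq_integrable_def power_mult_distrib)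

lemma sq_integrable_minus:
  assumes "sq_integrable f"
  shows "sq_integrable (\<lambda>t. - f t)"
  using assms by (auto simp: sq_integrable_def)

quotient_type L2 = "real \<Rightarrow> real" / partial: L2_eq
proof (rule part_equivpI)
  show "\<exists>f. L2_eq f f"
    using sq_integrable_zero by (auto simp: L2_eq_def)
  show "symp L2_eq"
    by (rule sympI) (auto simp: L2_eq_def elim: eventually_mono)
  show "transp L2_eq"
  proof (rule transpI)
    fix f g h assume "L2_eq f g" "L2_eq g h"
    moreover from this have "AE t in lborel. f t = h t"
      unfolding L2_eq_def by (auto elim: eventually_elim2)
    ultimately show "L2_eq f h" by (simp add: L2_eq_def)
  qed
qed

instantiation L2 :: real_vector
begin

lift_definition zero_L2 :: L2 is "\<lambda>_. 0"
  by (simp add: L2_eq_def sq_integrable_zero)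

lift_definition plus_L2 :: "L2 \<Rightarrow> L2 \<Rightarrow> L2" is "\<lambda>f g t. f t + g t"
  by (auto simp: L2_eq_def sq_integrable_add elim: eventually_elim2)

lift_definition uminus_L2 :: "L2 \<Rightarrow> L2" is "\<lambda>f t. - f t"
  by (auto simp: L2_eq_def sq_integrable_minus elim: eventually_mono)

definition minus_L2 :: "L2 \<Rightarrow> L2 \<Rightarrow> L2" where
  "minus_L2 f g = f + - g"

lift_definition scaleR_L2 :: "real \<Rightarrow> L2 \<Rightarrow> L2" is "\<lambda>c f t. c * f t"
  by (auto simp: L2_eq_def sq_integrable_scale elim: eventually_mono)

instance
proof
  fix f g h :: L2 and a b :: real
  show "f + g + h = f + (g + h)"
    by transfer (auto simp: L2_eq_def add.assoc intro!: sq_integrable_add)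
  show "f + g = g + f"
    by transfer (auto simp: L2_eq_def add.commute intro!: sq_integrable_add)
  show "0 + f = f"
    by transfer (auto simp: L2_eq_def)
  show "- f + f = 0"
    by transfer (auto simp: L2_eq_def sq_integrable_zero)
  show "f - g = f + - g"
    by (rule minus_L2_def)
  show "a *\<^sub>R (f + g) = a *\<^sub>R f + a *\<^sub>R g"
    by transfer
      (auto simp: L2_eq_def distrib_left intro!: sq_integrable_add sq_integrable_scale)
  show "(a + b) *\<^sub>R f = a *\<^sub>R f + b *\<^sub>R f"
    by transfer
      (auto simp: L2_eq_def distrib_right intro!: sq_integrable_add sq_integrable_scale)
  show "a *\<^sub>R b *\<^sub>R f = (a * b) *\<^sub>R f"
    by transfer
      (auto simp: L2_eq_def mult.assoc intro!: sq_integrable_scale)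
  show "1 *\<^sub>R f = f"
    by transfer (auto simp: L2_eq_def)
qed

end

instantiation L2 :: real_inner
begin

lift_definition inner_L2 :: "L2 \<Rightarrow> L2 \<Rightarrow> real" is
  "\<lambda>f g. LINT t|lborel. f t * g t"
  by (rule integral_cong_AE)
    (auto simp: L2_eq_def sq_integrable_def elim: eventually_elim2)

definition norm_L2 :: "L2 \<Rightarrow> real" where
  "norm_L2 f = sqrt (inner f f)"

definition sgn_L2 :: "L2 \<Rightarrow> L2" where
  "sgn_L2 f = inverse (norm f) *\<^sub>R f"

definition dist_L2 :: "L2 \<Rightarrow> L2 \<Rightarrow> real" where
  "dist_L2 f g = norm (f - g)"

definition uniformity_L2 :: "(L2 \<times> L2) filter" where
  "uniformity_L2 = (INF e\<in>{0<..}. principal {(f, g). dist f g < e})"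

definition open_L2 :: "L2 set \<Rightarrow> bool" where
  "open_L2 U \<longleftrightarrow> (\<forall>f\<in>U. eventually (\<lambda>(f', g). f' = f \<longrightarrow> g \<in> U) uniformity)"

instance
proof
  fix f g h :: L2 and r :: real and U :: "L2 set"
  show "dist f g = norm (f - g)" by (rule dist_L2_def)
  show "sgn f = f /\<^sub>R norm f" by (simp add: sgn_L2_def)
  show "uniformity = (INF e\<in>{0<..}. principal {(f, g :: L2). dist f g < e})"
    by (rule uniformity_L2_def)
  show "open U \<longleftrightarrow> (\<forall>f\<in>U. eventually (\<lambda>(f', g). f' = f \<longrightarrow> g \<in> U) uniformity)"
    by (rule open_L2_def)
  show "inner f g = inner g f"
    by transfer (simp add: mult.commute)
  show "inner (f + g) h = inner f h + inner g h"
    by transfer (simp add: L2_eq_def distrib_right sq_integrable_mult)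
  show "inner (r *\<^sub>R f) g = r * inner f g"
    by transfer (simp add: mult.assoc)
  show "0 \<le> inner f f"
    by transfer simp
  show "inner f f = 0 \<longleftrightarrow> f = 0"
  proof transfer
    fix f assume f: "L2_eq f f"
    have "(LINT t|lborel. f t * f t) = 0 \<longleftrightarrow> (AE t in lborel. f t * f t = 0)"
      using f by (intro integral_nonneg_eq_0_iff_AE) (auto simp: L2_eq_def sq_integrable_mult)
    then show "(LINT t|lborel. f t * f t) = 0 \<longleftrightarrow> L2_eq f (\<lambda>_. 0)"
      using f by (simp add: L2_eq_def sq_integrable_zero)
  qed
  show "norm f = sqrt (inner f f)" by (rule norm_L2_def)
qed

end


section \<open>The state space and the operator\<close>

text \<open>
  The space \<open>L\<^sup>2(-d, 0)\<close> is the closed subspace of those classes in \<open>L2\<close> that vanish almost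
  everywhere outside \<open>[-d, 0]\<close> (extension by zero is an isometry), so that \<open>X d\<close> carries the
  inner product of the product type \<open>real \<times> L2\<close>. Every notion below that takes an element of
  \<open>L2\<close> through its representative \<open>rep_L2\<close> is invariant under changes on null sets.
\<close>

definition L2_on :: "real \<Rightarrow> L2 set" where
  "L2_on d = {f. AE t in lborel. t \<notin> {-d..0} \<longrightarrow> rep_L2 f t = 0}"

definition X :: "real \<Rightarrow> (real \<times> L2) set" where
  "X d = UNIV \<times> L2_on d"

text \<open>
  Test functions of class \<open>C\<^sub>c\<^sup>1\<close> on the open interval; by density they determine the same weak
  derivatives as smooth ones.
\<close>

definition test_function :: "real \<Rightarrow> (real \<Rightarrow> real) \<Rightarrow> (real \<Rightarrow> real) \<Rightarrow> bool" where
  "test_function d \<phi> \<phi>' \<longleftrightarrow>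
     (\<forall>t. (\<phi> has_real_derivative \<phi>' t) (at t)) \<and> continuous_on UNIV \<phi>' \<and>
     (\<exists>a b. -d < a \<and> b < 0 \<and> (\<forall>t. t \<notin> {a..b} \<longrightarrow> \<phi> t = 0))"

definition weak_deriv :: "real \<Rightarrow> L2 \<Rightarrow> L2 \<Rightarrow> bool" where
  "weak_deriv d f g \<longleftrightarrow>
     (\<forall>\<phi> \<phi>'. test_function d \<phi> \<phi>' \<longrightarrow>
        (LINT s:{-d..0}|lborel. rep_L2 f s * \<phi>' s) = - (LINT s:{-d..0}|lborel. rep_L2 g s * \<phi> s))"

definition W12 :: "real \<Rightarrow> L2 set" where
  "W12 d = {f \<in> L2_on d. \<exists>g\<in>L2_on d. weak_deriv d f g}"

definition dds :: "real \<Rightarrow> L2 \<Rightarrow> L2" where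
  "dds d f = (THE g. g \<in> L2_on d \<and> weak_deriv d f g)"

text \<open>Point values of a class in \<open>W12 d\<close> are those of its continuous representative.\<close>

definition point_value :: "real \<Rightarrow> L2 \<Rightarrow> real \<Rightarrow> real" where
  "point_value d f s =
     (THE y. \<exists>F. continuous_on {-d..0} F \<and>
        (AE t in lborel. t \<in> {-d..0} \<longrightarrow> F t = rep_L2 f t) \<and> F s = y)"

definition D_Astar :: "real \<Rightarrow> (real \<times> L2) set" where
  "D_Astar d = {\<psi> \<in> X d. snd \<psi> \<in> W12 d \<and> fst \<psi> = point_value d (snd \<psi>) 0}"

definition Astar :: "real \<Rightarrow> real \<times> L2 \<Rightarrow> real \<times> L2" where
  "Astar d \<psi> = (0, dds d (snd \<psi>))"

definition graph_norm :: "real \<Rightarrow> real \<times> L2 \<Rightarrow> real" where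
  "graph_norm d \<psi> = norm \<psi> + norm (Astar d \<psi>)"

definition dirac_md :: "real \<Rightarrow> real \<times> L2 \<Rightarrow> real" where
  "dirac_md d \<psi> = point_value d (snd \<psi>) (-d)"


section \<open>The data of the problem\<close>

definition xi :: "real \<Rightarrow> real \<Rightarrow> real" where
  "xi At d = (THE z. z > 0 \<and> z = At * exp (- z * d))"

definition Gam :: "real \<Rightarrow> real \<Rightarrow> real \<times> L2 \<Rightarrow> real" where
  "Gam d \<xi> x = fst x + (LINT s:{-d..0}|lborel. exp (\<xi> * s) * rep_L2 (snd x) s)"

definition Q_set :: "real \<Rightarrow> real \<Rightarrow> (real \<times> L2) set" where
  "Q_set d \<xi> = {x \<in> X d. Gam d \<xi> x > 0}"

definition O_set :: "real \<Rightarrow> real \<Rightarrow> real \<Rightarrow> real \<Rightarrow> real \<Rightarrow> (real \<times> L2) set" where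
  "O_set A At d \<xi> \<alpha> = {x \<in> Q_set d \<xi>. Gam d \<xi> x < fst x * (A / (\<alpha> * At))}"


section \<open>The HJB equation and its classical solutions\<close>

text \<open>
  Only directions in \<open>X d\<close> matter for \<open>at x within X d\<close>, and the gradient is required to lie in
  \<open>X d\<close>: this is the Riesz representative of the Frechet derivative on the Hilbert space \<open>X d\<close>.
\<close>

definition gradient :: "real \<Rightarrow> (real \<times> L2 \<Rightarrow> real) \<Rightarrow> real \<times> L2 \<Rightarrow> real \<times> L2" where
  "gradient d v x = (THE p. p \<in> X d \<and> (v has_derivative (\<lambda>h. inner p h)) (at x within X d))"

text \<open>The value at \<open>0\<close> is \<open>-\<infinity>\<close> for \<open>\<sigma> > 1\<close>, where \<open>powr\<close> would give \<open>0\<close>.\<close>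

definition utility :: "real \<Rightarrow> real \<Rightarrow> ereal" where
  "utility \<sigma> c =
     (if \<sigma> > 1 \<and> c = 0 then -\<infinity> else ereal (c powr (1 - \<sigma>) / (1 - \<sigma>)))"

definition HJB_at ::
  "real \<Rightarrow> real \<Rightarrow> real \<Rightarrow> real \<Rightarrow> real \<Rightarrow> (real \<times> L2 \<Rightarrow> real) \<Rightarrow> real \<times> L2 \<Rightarrow> bool" where
  "HJB_at A At d \<rho> \<sigma> v x \<longleftrightarrow>
     ereal (\<rho> * v x) =
       ereal (inner x (Astar d (gradient d v x))) +
       (SUP u\<in>{(1 - A / At) * fst x .. fst x}.
          ereal (u * At * dirac_md d (gradient d v x)) + utility \<sigma> (fst x - u))"

definition classical_solution ::
  "real \<Rightarrow> real \<Rightarrow> real \<Rightarrow> real \<Rightarrow> real \<Rightarrow> (real \<times> L2) set \<Rightarrow> (real \<times> L2 \<Rightarrow> real) \<Rightarrow> bool" where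
  "classical_solution A At d \<rho> \<sigma> U v \<longleftrightarrow>
     openin (top_of_set (X d)) U \<and>
     (\<forall>x\<in>U. v differentiable (at x within X d)) \<and>
     continuous_on U (gradient d v) \<and>
     (\<forall>x\<in>U. gradient d v x \<in> D_Astar d) \<and>
     (\<forall>x\<in>U. ((\<lambda>y. graph_norm d (gradient d v y - gradient d v x)) \<longlongrightarrow> 0) (at x within U)) \<and>
     (\<forall>x\<in>U. HJB_at A At d \<rho> \<sigma> v x)"

end

(* The functional Gamma is the inner product with g = (1, exp (xi .)), so Dv = k(x) g with
   k(x) = nu Gamma(x)^(-sigma), and Astar g = (0, xi exp (xi .)) because g lies in D(Astar).
   Since At exp (-xi d) = xi, the Hamiltonian maximises u m^(-sigma) + (x0 - u)^(1-sigma)/(1-sigma)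
   with m = alpha Gamma(x); by concavity the maximiser is x0 - u = m, which is admissible exactly
   because x lies in O. The equation is then an identity in m and Gamma(x). *)

theory Submission
  imports Defs
begin

text \<open>The constants come from matching coefficients. For \<open>v\<close> of the form \<nu>
  \<open>Gam\<close>^(1-\<sigma>)/(1-\<sigma>), the first-order condition
  \<open>m powr (-\<sigma>)\<close> = \<xi> \<open>k x\<close> makes the optimal consumption
  \<open>m\<close> a multiple of \<open>Gam d \<xi> x\<close>; calling the factor \<alpha> gives
  \<nu> = \<alpha>^(-\<sigma>)/\<xi>. In the equation the terms in \<open>fst x\<close> cancel, and
  the coefficients of \<open>Gam\<close> leave \<rho> = \<xi>(1-\<sigma>+\<sigma>\<alpha>). The
  assumption \<rho> > \<xi>(1-\<sigma>) is precisely \<alpha> > 0. Most of the work is uniqueness: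
  \<open>gradient\<close>, \<open>dds\<close>, \<open>point_value\<close> and \<open>xi\<close> are
  definite descriptions, so exhibiting a candidate does not yet evaluate them. For
  \<open>dds\<close> this calls for the fundamental lemma of the calculus of variations.\<close>

section \<open>Representatives of square-integrable classes\<close>

lemma sq_integrable_rep: "sq_integrable (rep_L2 f)"
  using Quotient3_rep_reflp[OF Quotient3_L2, of f] by (simp add: L2_eq_def)

lemma rep_abs_L2_AE:
  assumes "sq_integrable f"
  shows "AE t in lborel. rep_L2 (abs_L2 f) t = f t"
proof -
  have "L2_eq f f" using assms by (simp add: L2_eq_def)
  then have "L2_eq (rep_L2 (abs_L2 f)) f"
    by (rule Quotient3_rep_abs[OF Quotient3_L2])
  then show ?thesis by (simp add: L2_eq_def)
qed

lemma abs_rep_L2: "abs_L2 (rep_L2 f) = f"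
  by (rule Quotient3_abs_rep[OF Quotient3_L2])

lemma L2_eqI:
  assumes "AE t in lborel. rep_L2 f t = rep_L2 g t"
  shows "f = g"
proof -
  have "L2_eq (rep_L2 f) (rep_L2 g)"
    using assms by (simp add: L2_eq_def sq_integrable_rep)
  then have "abs_L2 (rep_L2 f) = abs_L2 (rep_L2 g)"
    by (rule Quotient3_rel_abs[OF Quotient3_L2])
  then show ?thesis by (simp add: abs_rep_L2)
qed

text \<open>\<open>rep_L2\<close> picks an arbitrary member of a class, so it commutes with the
  vector operations only up to a null set.\<close>

lemma rep_scaleR_AE: "AE t in lborel. rep_L2 (c *\<^sub>R f) t = c * rep_L2 f t"
proof -
  have "c *\<^sub>R f = abs_L2 (\<lambda>t. c * rep_L2 f t)"
    using scaleR_L2.abs_eq[of "rep_L2 f" c] by (simp add: abs_rep_L2 L2_eq_def sq_integrable_rep)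
  then show ?thesis
    using rep_abs_L2_AE[OF sq_integrable_scale[OF sq_integrable_rep]] by simp
qed

lemma rep_add_AE: "AE t in lborel. rep_L2 (f + g) t = rep_L2 f t + rep_L2 g t"
proof -
  have "f + g = abs_L2 (\<lambda>t. rep_L2 f t + rep_L2 g t)"
    using plus_L2.abs_eq[of "rep_L2 f" "rep_L2 g"]
    by (simp add: abs_rep_L2 L2_eq_def sq_integrable_rep)
  then show ?thesis
    using rep_abs_L2_AE[OF sq_integrable_add[OF sq_integrable_rep sq_integrable_rep]] by simp
qed

lemma inner_L2_rep: "inner f g = (LINT t|lborel. rep_L2 f t * rep_L2 g t)"
  using inner_L2.abs_eq[of "rep_L2 f" "rep_L2 g"]
  by (simp add: abs_rep_L2 L2_eq_def sq_integrable_rep)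

lemma L2_on_add: "f \<in> L2_on d \<Longrightarrow> g \<in> L2_on d \<Longrightarrow> f + g \<in> L2_on d"
  using rep_add_AE[of f g] unfolding L2_on_def by (auto elim: eventually_elim2) 

lemma L2_on_scaleR: "f \<in> L2_on d \<Longrightarrow> c *\<^sub>R f \<in> L2_on d"
  using rep_scaleR_AE[of c f] unfolding L2_on_def by (auto elim: eventually_elim2)

lemma X_add: "x \<in> X d \<Longrightarrow> y \<in> X d \<Longrightarrow> x + y \<in> X d"
  by (auto simp: X_def L2_on_add)

lemma X_scaleR: "x \<in> X d \<Longrightarrow> c *\<^sub>R x \<in> X d"
  by (auto simp: X_def L2_on_scaleR)

lemma X_diff: "x \<in> X d \<Longrightarrow> y \<in> X d \<Longrightarrow> x - y \<in> X d"
  using X_add[of x d "-1 *\<^sub>R y"] X_scaleR[of y d "-1"] by simp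

section \<open>Uniqueness of gradients and of continuous representatives\<close>

text \<open>\<open>X d\<close> has empty interior in \<open>real \<times> L2\<close>, so uniqueness
  of derivatives at interior points does not apply. The difference \<open>q - p\<close> of two
  candidates lies in \<open>X d\<close> itself; along the line through \<open>x\<close> in this
  direction, uniqueness for functions of one real variable forces \<open>q - p\<close> to be
  orthogonal to itself.\<close>

lemma gradient_eqI:
  assumes x: "x \<in> X d" and p: "p \<in> X d"
    and der: "(v has_derivative (\<lambda>h. inner p h)) (at x within X d)"
  shows "gradient d v x = p"
  unfolding gradient_def
proof (rule the_equality)
  fix q assume "q \<in> X d \<and> (v has_derivative (\<lambda>h. inner q h)) (at x within X d)"
  then have q: "q \<in> X d" and dq: "(v has_derivative (\<lambda>h. inner q h)) (at x within X d)" by auto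
  let ?z = "q - p"
  let ?c = "\<lambda>t::real. x + t *\<^sub>R ?z"
  have sub: "range ?c \<subseteq> X d" using x p q by (auto intro!: X_add X_scaleR X_diff)
  have c: "(?c has_derivative (\<lambda>t. t *\<^sub>R ?z)) (at 0)"
    by (auto intro!: derivative_eq_intros)
  have *: "((\<lambda>t. v (?c t)) has_derivative (\<lambda>t. inner r (t *\<^sub>R ?z))) (at 0)"
    if "(v has_derivative (\<lambda>h. inner r h)) (at x within X d)" for r
  proof -
    have "(v has_derivative (\<lambda>h. inner r h)) (at (?c 0) within range ?c)"
      using has_derivative_subset[OF that sub] by simp
    from has_derivative_in_compose[OF c this] show ?thesis .
  qed
  have "(\<lambda>t. inner q (t *\<^sub>R ?z)) = (\<lambda>t. inner p (t *\<^sub>R ?z))"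
    by (rule has_derivative_unique[OF *[OF dq] *[OF der]])
  from fun_cong[OF this, of 1] have "inner ?z ?z = 0" by (simp add: inner_diff_left)
  then show "q = p" by simp
qed (use p der in auto)

text \<open>If the continuous difference were nonzero at \<open>s\<close>, it would be nonzero on an
  interval of positive length, which is not a null set.\<close>

lemma AE_continuous_unique:
  fixes F G :: "real \<Rightarrow> real"
  assumes ab: "a < b" and F: "continuous_on {a..b} F" and G: "continuous_on {a..b} G"
    and ae: "AE t in lborel. t \<in> {a..b} \<longrightarrow> F t = G t" and s: "s \<in> {a..b}"
  shows "F s = G s"
proof (rule ccontr)
  assume "F s \<noteq> G s"
  then have pos: "\<bar>F s - G s\<bar> > 0" by simp
  have "continuous_on {a..b} (\<lambda>t. F t - G t)" using F G by (rule continuous_on_diff)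
  then obtain e where e: "e > 0"
    and far: "\<And>t. t \<in> {a..b} \<Longrightarrow> \<bar>t - s\<bar> < e \<Longrightarrow> \<bar>(F t - G t) - (F s - G s)\<bar> < \<bar>F s - G s\<bar>"
    using s pos unfolding continuous_on_iff dist_real_def by blast
  \<comment> \<open>Clipping to \<open>{a..b}\<close> leaves an interval of positive length even if
    \<open>s\<close> is an endpoint, the case needed for point values at \<open>-d\<close> and
    \<open>0\<close>.\<close>
  let ?l = "max a (s - e)" and ?u = "min b (s + e)"
  have lu: "?l < ?u" using ab s e by auto
  have "AE t in lborel. \<not> t \<in> {?l<..<?u}"
    using ae
  proof eventually_elim
    case (elim t)
    show ?case
    proof
      assume "t \<in> {?l<..<?u}"
      then have "t \<in> {a..b}" "\<bar>t - s\<bar> < e" by auto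
      with far[OF this] elim show False by auto
    qed
  qed
  then have "emeasure lborel {x \<in> space lborel. x \<in> {?l<..<?u}} = 0"
    by (rule emeasure_eq_0_AE)
  moreover have "{x \<in> space lborel. x \<in> {?l<..<?u}} = {?l<..<?u}" by auto
  moreover have "emeasure lborel {?l<..<?u} = ennreal (?u - ?l)"
    using lu by (intro emeasure_lborel_Ioo) simp
  ultimately show False using lu ennreal_eq_0_iff[of "?u - ?l"] by (auto simp del: max_less_iff_conj min_less_iff_conj)
qed

lemma point_value_eqI:
  assumes d: "d > 0" and F: "continuous_on {-d..0} F"
    and ae: "AE t in lborel. t \<in> {-d..0} \<longrightarrow> F t = rep_L2 f t" and s: "s \<in> {-d..0}"
  shows "point_value d f s = F s"
  unfolding point_value_def
proof (rule the_equality)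
  fix y assume "\<exists>F. continuous_on {-d..0} F \<and>
        (AE t in lborel. t \<in> {-d..0} \<longrightarrow> F t = rep_L2 f t) \<and> F s = y"
  then obtain G where G: "continuous_on {-d..0} G"
      "AE t in lborel. t \<in> {-d..0} \<longrightarrow> G t = rep_L2 f t" "G s = y" by blast
  have "AE t in lborel. t \<in> {-d..0} \<longrightarrow> G t = F t"
    using G(2) ae by eventually_elim auto
  then show "y = F s"
    using AE_continuous_unique[OF _ G(1) F _ s] d G(3) by auto
qed (use F ae in auto)

section \<open>Fundamental lemma of the calculus of variations\<close>

text \<open>The square smooths the corners of the positive part at \<open>a\<close> and
  \<open>b\<close>; this gives exactly the class C^1 that \<open>test_function\<close> asks
  for.\<close>

definition bump :: "real \<Rightarrow> real \<Rightarrow> real \<Rightarrow> real" where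
  "bump a b t = (max 0 ((t - a) * (b - t)))\<^sup>2"

lemma has_real_derivative_max0_sq:
  "((\<lambda>y::real. (max 0 y)\<^sup>2) has_real_derivative 2 * max 0 y) (at y)"
proof (cases "y = 0")
  case True
  have "((\<lambda>h::real. (max 0 h)\<^sup>2 / h) \<longlongrightarrow> 0) (at 0)"
  proof (rule Lim_null_comparison)
    show "\<forall>\<^sub>F h::real in at 0. norm ((max 0 h)\<^sup>2 / h) \<le> \<bar>h\<bar>"
      by (rule always_eventually) (auto simp: max_def power2_eq_square)
    show "((\<lambda>h::real. \<bar>h\<bar>) \<longlongrightarrow> 0) (at 0)"
      using tendsto_rabs_zero[OF tendsto_ident_at] .
  qed
  then show ?thesis using True by (simp add: DERIV_def)
next
  case False
  show ?thesis
  proof (cases "y > 0")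
    case True
    have "((\<lambda>y::real. y\<^sup>2) has_real_derivative 2 * max 0 y) (at y)"
      using True by (auto intro!: derivative_eq_intros)
    moreover have "\<forall>\<^sub>F z in nhds y. z\<^sup>2 = (max 0 z)\<^sup>2"
      using eventually_nhds_in_open[of "{0<..}" y] True
      by (auto elim!: eventually_mono)
    ultimately show ?thesis by (rule DERIV_cong_ev[OF refl _ refl, THEN iffD1, rotated])
  next
    case F: False
    have "((\<lambda>y::real. 0) has_real_derivative 2 * max 0 y) (at y)"
      using F by (auto intro!: derivative_eq_intros)
    moreover have "\<forall>\<^sub>F z in nhds y. 0 = (max 0 z)\<^sup>2"
      using eventually_nhds_in_open[of "{..<0}" y] F False
      by (auto elim!: eventually_mono)
    ultimately show ?thesis by (rule DERIV_cong_ev[OF refl _ refl, THEN iffD1, rotated])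
  qed
qed

text \<open>As \<open>n \<longrightarrow> \<infinity>\<close>, these test functions increase to the indicator of the open interval.\<close>

lemma test_function_bump:
  assumes "-d < a" "a \<le> b" "b < 0"
  obtains \<phi>' where "test_function d (\<lambda>t. 1 - exp (- (n * bump a b t))) \<phi>'"
proof -
  let ?w = "\<lambda>t. (t - a) * (b - t)"
  let ?w' = "\<lambda>t. (b - t) - (t - a)"
  let ?D = "\<lambda>t. n * (2 * max 0 (?w t) * ?w' t) * exp (- (n * bump a b t))"
  have bump: "(bump a b has_real_derivative 2 * max 0 (?w t) * ?w' t) (at t)" for t
  proof -
    have "(?w has_real_derivative ?w' t) (at t)"
      by (auto intro!: derivative_eq_intros)
    from DERIV_chain2[OF has_real_derivative_max0_sq this]
    show ?thesis unfolding bump_def[abs_def] .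
  qed
  have "((\<lambda>t. 1 - exp (- (n * bump a b t))) has_real_derivative ?D t) (at t)" for t
    by (rule derivative_eq_intros bump refl | simp)+
  moreover have "continuous_on UNIV ?D"
    unfolding bump_def by (intro continuous_intros)
  moreover have "1 - exp (- (n * bump a b t)) = 0" if "t \<notin> {a..b}" for t
  proof -
    have "?w t \<le> 0" using that assms by (auto simp: mult_le_0_iff)
    then show ?thesis by (simp add: bump_def max_def)
  qed
  ultimately have "test_function d (\<lambda>t. 1 - exp (- (n * bump a b t))) ?D"
    unfolding test_function_def using assms by blast
  then show ?thesis by (rule that)
qed

text \<open>The indicator of an open subinterval is a pointwise limit of test functions bounded by
  1, so dominated convergence with majorant \<open>\<bar>h\<bar>\<close> on \<open>{-d..0}\<close>
  carries the vanishing integrals to the limit.\<close>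

lemma set_integral_eq_0_Ioo:
  fixes h :: "real \<Rightarrow> real"
  assumes h: "set_integrable lborel {-d..0} h"
    and test: "\<And>\<phi> \<phi>'. test_function d \<phi> \<phi>' \<Longrightarrow> (LINT s:{-d..0}|lborel. h s * \<phi> s) = 0"
    and ab: "-d \<le> a" "a < b" "b \<le> 0"
  shows "(LINT s:{a<..<b}|lborel. h s) = 0"
proof -
  \<comment> \<open>The interval is shrunk because a test function must have support inside the open
    \<open>(-d, 0)\<close>, while \<open>a = -d\<close> and \<open>b = 0\<close> are allowed here.\<close>
  define e where "e n = (b - a) / (real n + 3)" for n
  define \<phi> where "\<phi> n t = 1 - exp (- (real n * bump (a + e n) (b - e n) t))" for n t
  have e: "e n > 0" "a + e n \<le> b - e n" for n
  proof -
    show "e n > 0" using ab by (simp add: e_def)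
    have "(b - a) * (2 / (real n + 3)) \<le> b - a" using ab by (intro mult_left_le) auto
    then have "2 * e n \<le> b - a" by (simp add: e_def algebra_simps)
    then show "a + e n \<le> b - e n" by simp
  qed
  have e0: "e \<longlonglongrightarrow> 0"
  proof -
    have "(\<lambda>n. (b - a) * inverse (real n + 3)) \<longlonglongrightarrow> (b - a) * 0"
      using LIMSEQ_ignore_initial_segment[OF lim_inverse_n, of 3]
      by (intro tendsto_mult tendsto_const) simp
    then show ?thesis by (simp add: e_def[abs_def] divide_inverse)
  qed
  have out: "\<phi> n t = 0" if "t \<notin> {a<..<b}" for n t
  proof -
    have "(t - (a + e n)) * ((b - e n) - t) \<le> 0"
      using that e[of n] by (auto simp: mult_le_0_iff)
    then show ?thesis by (simp add: \<phi>_def bump_def max_def)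
  qed
  have bd: "\<bar>\<phi> n t\<bar> \<le> 1" for n t
    by (simp add: \<phi>_def bump_def)
  have lim: "(\<lambda>n. \<phi> n t) \<longlonglongrightarrow> 1" if t: "t \<in> {a<..<b}" for t
  proof -
    \<comment> \<open>The interval moves with \<open>n\<close>, so the bump at \<open>t\<close> is
      not constant in \<open>n\<close>; its positive limit suffices to drive the exponent to minus
      infinity.\<close>
    have "(\<lambda>n. bump (a + e n) (b - e n) t) \<longlonglongrightarrow> (max 0 ((t - (a + 0)) * ((b - 0) - t)))\<^sup>2"
      unfolding bump_def by (intro tendsto_intros e0)
    moreover have "(max 0 ((t - (a + 0)) * ((b - 0) - t)))\<^sup>2 > 0"
      using t by (simp add: max_def)
    ultimately have "filterlim (\<lambda>n. real n * bump (a + e n) (b - e n) t) at_top sequentially"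
      by (subst mult.commute)
        (rule filterlim_tendsto_pos_mult_at_top[OF _ _ filterlim_real_sequentially])
    then have "(\<lambda>n. exp (- (real n * bump (a + e n) (b - e n) t))) \<longlonglongrightarrow> 0"
      by (intro filterlim_compose[OF exp_at_bot] filterlim_uminus_at_bot_at_top[THEN filterlim_compose])
    then have "(\<lambda>n. 1 - exp (- (real n * bump (a + e n) (b - e n) t))) \<longlonglongrightarrow> 1 - 0"
      by (intro tendsto_diff tendsto_const)
    then show ?thesis by (simp add: \<phi>_def)
  qed
  let ?h = "\<lambda>s. indicator {-d..0} s * h s"
  have hi: "integrable lborel ?h" using h by (simp add: set_integrable_def)
  note [measurable] = borel_measurable_integrable[OF hi]
  have "(\<lambda>n. LINT s|lborel. ?h s * \<phi> n s) \<longlonglongrightarrow> (LINT s|lborel. ?h s * indicator {a<..<b} s)"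
  proof (rule integral_dominated_convergence[where w = "\<lambda>s. norm (?h s)"])
    show "(\<lambda>s. ?h s * indicator {a<..<b} s) \<in> borel_measurable lborel" by measurable
    show "(\<lambda>s. ?h s * \<phi> n s) \<in> borel_measurable lborel" for n
      unfolding \<phi>_def bump_def by measurable
    show "integrable lborel (\<lambda>s. norm (?h s))" using hi by (rule integrable_norm)
    show "AE s in lborel. (\<lambda>n. ?h s * \<phi> n s) \<longlonglongrightarrow> ?h s * indicator {a<..<b} s"
    proof (rule AE_I2)
      fix s
      have "(\<lambda>n. \<phi> n s) \<longlonglongrightarrow> indicator {a<..<b} s"
        using lim[of s] out[of s] by (cases "s \<in> {a<..<b}") auto
      then show "(\<lambda>n. ?h s * \<phi> n s) \<longlonglongrightarrow> ?h s * indicator {a<..<b} s"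
        by (intro tendsto_mult tendsto_const)
    qed
    show "AE s in lborel. norm (?h s * \<phi> n s) \<le> norm (?h s)" for n
      unfolding norm_mult using bd by (intro AE_I2 mult_left_le) auto
  qed
  moreover have "(LINT s|lborel. ?h s * \<phi> n s) = 0" for n
  proof -
    obtain \<phi>' where "test_function d (\<phi> n) \<phi>'"
      using test_function_bump[of d "a + e n" "b - e n" "real n"] e[of n] ab
      unfolding \<phi>_def[abs_def] by auto
    from test[OF this] show ?thesis by (simp add: set_lebesgue_integral_def mult.assoc)
  qed
  ultimately have "(LINT s|lborel. ?h s * indicator {a<..<b} s) = 0"
    by (simp add: LIMSEQ_const_iff)
  moreover have "(\<lambda>s. ?h s * indicator {a<..<b} s) = (\<lambda>s. indicator {a<..<b} s *\<^sub>R h s)"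
    using ab by (auto simp: indicator_def fun_eq_iff)
  ultimately show ?thesis by (simp add: set_lebesgue_integral_def)
qed

text \<open>Dynkin's \<pi>-\<lambda> argument: open rays are closed under intersection and generate
  the Borel sets, and the integral over the whole line handles complements. A density whose integral
  over every Borel set is zero vanishes almost everywhere.\<close>

lemma AE_zero_if_Ioi_integrals_zero:
  fixes f :: "real \<Rightarrow> real"
  assumes f: "integrable lborel f"
    and Ioi: "\<And>a. (LINT s:{a<..}|lborel. f s) = 0" and all: "(LINT s|lborel. f s) = 0"
  shows "AE s in lborel. f s = 0"
proof (rule density_unique_real[OF f integrable_zero])
  fix A :: "real set" assume "A \<in> sets lborel"
  then have A: "A \<in> sigma_sets UNIV (range greaterThan)"
    by (simp add: borel_Ioi)
  have si: "set_integrable lborel B f" if "B \<in> sigma_sets UNIV (range greaterThan)" for B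
    using that f integrable_mult_indicator[of B lborel f]
    by (simp add: set_integrable_def borel_Ioi)
  have Int_stable: "Int_stable (range (greaterThan :: real \<Rightarrow> _))"
    by (auto simp: Int_stable_def lessThan_Int_lessThan)
  have subset: "range (greaterThan :: real \<Rightarrow> _) \<subseteq> Pow UNIV" by simp
  have "(LINT s:A|lborel. f s) = 0"
    using Int_stable subset A
  proof (induction rule: sigma_sets_induct_disjoint)
    case (basic B)
    then show ?case using Ioi by auto
  next
    case empty show ?case by (simp add: set_lebesgue_integral_def)
  next
    case (compl B)
    have "(LINT s:UNIV - B|lborel. f s) = (LINT s|lborel. f s - indicator B s *\<^sub>R f s)"
      unfolding set_lebesgue_integral_def
      by (rule Bochner_Integration.integral_cong) (auto simp: indicator_def)
    also have "\<dots> = 0"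
      using si[OF compl(1)] f compl(2) all
      by (simp add: set_lebesgue_integral_def set_integrable_def)
    finally show ?case .
  next
    case (union B)
    have "B i \<in> sets lborel" for i using union(2) by (auto simp: borel_Ioi)
    moreover have "set_integrable lborel (\<Union>i. B i) f"
      using union(2) by (intro si sigma_sets.Union) auto
    ultimately have "(LINT s:(\<Union>i. B i)|lborel. f s) = (\<Sum>i. LINT s:B i|lborel. f s)"
      using union(1) by (intro lebesgue_integral_countable_add) (auto simp: disjoint_family_on_def)
    then show ?case using union(3) by simp
  qed
  then show "(LINT s:A|lborel. f s) = (LINT s:A|lborel. 0)" by simp
qed

text \<open>Extending \<open>h\<close> by zero from the open interval reduces integrals over rays to
  integrals over open subintervals of \<open>(-d, 0)\<close>, possibly empty, where test functions
  are available.\<close>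

lemma fundamental_lemma:
  fixes h :: "real \<Rightarrow> real"
  assumes d: "d > 0" and h: "set_integrable lborel {-d..0} h"
    and test: "\<And>\<phi> \<phi>'. test_function d \<phi> \<phi>' \<Longrightarrow> (LINT s:{-d..0}|lborel. h s * \<phi> s) = 0"
  shows "AE s in lborel. s \<in> {-d..0} \<longrightarrow> h s = 0"
proof -
  let ?f = "\<lambda>s. indicator {-d<..<0} s *\<^sub>R h s"
  have f: "integrable lborel ?f"
    using set_integrable_subset[OF h, of "{-d<..<0}"]
    by (simp add: set_integrable_def greaterThanLessThan_subseteq_atLeastAtMost_iff)
  have Ioo: "(LINT s:{a<..<b}|lborel. h s) = 0" if "-d \<le> a" "a < b" "b \<le> 0" for a b
    using set_integral_eq_0_Ioo[OF h test that] .
  have "(LINT s:{a<..}|lborel. ?f s) = 0" for a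
  proof -
    have *: "(\<lambda>s. indicator {a<..} s *\<^sub>R ?f s) = (\<lambda>s. indicator {max a (-d)<..<0} s *\<^sub>R h s)"
      by (auto simp: indicator_def fun_eq_iff)
    show ?thesis
      unfolding set_lebesgue_integral_def *
    proof (cases "a < 0")
      case True
      then show "(LINT s|lborel. indicator {max a (-d)<..<0} s *\<^sub>R h s) = 0"
        using Ioo[of "max a (-d)" 0] d by (simp add: set_lebesgue_integral_def)
    next
      case False
      then have "{max a (-d)<..<0} = {}" by auto
      then show "(LINT s|lborel. indicator {max a (-d)<..<0} s *\<^sub>R h s) = 0"
        by simp
    qed
  qed
  moreover have "(LINT s|lborel. ?f s) = 0"
    using Ioo[of "-d" 0] d by (simp add: set_lebesgue_integral_def)
  ultimately have "AE s in lborel. ?f s = 0"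
    using AE_zero_if_Ioi_integrals_zero[OF f] by blast
  \<comment> \<open>\<open>?f\<close> says nothing about \<open>h\<close> at the two endpoints,
    which form a null set.\<close>
  moreover have "AE s in lborel. s \<noteq> -d" "AE s in lborel. s \<noteq> (0::real)"
    by (rule AE_lborel_singleton)+
  ultimately show ?thesis
    by eventually_elim (auto simp: indicator_def split: if_splits)
qed

section \<open>Uniqueness of weak derivatives\<close>

lemma sq_integrable_indicator_continuous:
  assumes "continuous_on {a..b} F"
  shows "sq_integrable (\<lambda>s. indicator {a..b} s * F s)"
proof -
  have "set_integrable lborel {a..b} (\<lambda>s. (F s)\<^sup>2)"
    using assms by (intro borel_integrable_atLeastAtMost' continuous_intros)
  moreover have "(\<lambda>s. indicator {a..b} s *\<^sub>R (F s)\<^sup>2) = (\<lambda>s. (indicator {a..b} s * F s)\<^sup>2)"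
    by (auto simp: indicator_def fun_eq_iff)
  moreover have "(\<lambda>s. indicator {a..b} s *\<^sub>R F s) \<in> borel_measurable borel"
    using assms by (intro borel_measurable_continuous_on_indicator) auto
  ultimately show ?thesis by (simp add: sq_integrable_def set_integrable_def)
qed

lemma set_integrable_rep_mult:
  assumes "continuous_on {a..b} \<phi>"
  shows "set_integrable lborel {a..b} (\<lambda>s. rep_L2 f s * \<phi> s)"
  using sq_integrable_mult[OF sq_integrable_rep sq_integrable_indicator_continuous[OF assms], of f]
  by (simp add: set_integrable_def mult.left_commute)

lemma test_function_continuous:
  assumes "test_function d \<phi> \<phi>'"
  shows "continuous_on S \<phi>"
  using assms unfolding test_function_def
  by (meson DERIV_isCont continuous_at_imp_continuous_on)

lemma dds_eqI:
  assumes d: "d > 0" and g: "g \<in> L2_on d" and w: "weak_deriv d f g"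
  shows "dds d f = g"
  unfolding dds_def
proof (rule the_equality)
  fix g' assume "g' \<in> L2_on d \<and> weak_deriv d f g'"
  then have g': "g' \<in> L2_on d" and w': "weak_deriv d f g'" by auto
  have "AE s in lborel. s \<in> {-d..0} \<longrightarrow> rep_L2 g' s - rep_L2 g s = 0"
  proof (rule fundamental_lemma[OF d])
    show "set_integrable lborel {-d..0} (\<lambda>s. rep_L2 g' s - rep_L2 g s)"
      \<comment> \<open>Pairing with the constant 1 shows that square-integrable functions are
        integrable on the bounded interval.\<close>
      using set_integrable_rep_mult[of "-d" 0 "\<lambda>_. 1"] by simp
    fix \<phi> \<phi>' assume t: "test_function d \<phi> \<phi>'"
    have "(LINT s:{-d..0}|lborel. (rep_L2 g' s - rep_L2 g s) * \<phi> s) =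
        (LINT s:{-d..0}|lborel. rep_L2 g' s * \<phi> s) - (LINT s:{-d..0}|lborel. rep_L2 g s * \<phi> s)"
      unfolding left_diff_distrib
      by (intro set_integral_diff set_integrable_rep_mult test_function_continuous[OF t])
    then show "(LINT s:{-d..0}|lborel. (rep_L2 g' s - rep_L2 g s) * \<phi> s) = 0"
      using w w' t unfolding weak_deriv_def by fastforce
  qed
  \<comment> \<open>Outside \<open>{-d..0}\<close> both representatives vanish almost everywhere, so
    agreement on the interval identifies the classes.\<close>
  then have "AE t in lborel. rep_L2 g' t = rep_L2 g t"
    using g g' unfolding L2_on_def mem_Collect_eq by eventually_elim auto
  then show "g' = g" by (rule L2_eqI)
qed (use g w in auto)

section \<open>The exponential in the domain of the operator\<close>

text \<open>The truncation is essential: on the whole line the exponential is not square-integrable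
  for any \<xi>.\<close>

definition exp_L2 :: "real \<Rightarrow> real \<Rightarrow> L2" where
  "exp_L2 d \<xi> = abs_L2 (\<lambda>s. indicator {-d..0} s * exp (\<xi> * s))"

text \<open>The factor \<open>k\<close> is carried along because \<open>point_value\<close> and
  \<open>dds\<close> are definite descriptions, whose linearity is not immediate, and they have to
  be evaluated at every multiple that occurs as a gradient.\<close>

lemma rep_exp_L2_AE:
  "AE t in lborel. rep_L2 (k *\<^sub>R exp_L2 d \<xi>) t = k * (indicator {-d..0} t * exp (\<xi> * t))"
proof -
  have "AE t in lborel. rep_L2 (exp_L2 d \<xi>) t = indicator {-d..0} t * exp (\<xi> * t)"
    unfolding exp_L2_def
    by (intro rep_abs_L2_AE sq_integrable_indicator_continuous continuous_intros)
  with rep_scaleR_AE[of k "exp_L2 d \<xi>"] show ?thesis by eventually_elim simp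
qed

lemma exp_L2_on: "k *\<^sub>R exp_L2 d \<xi> \<in> L2_on d"
  unfolding L2_on_def mem_Collect_eq
  using rep_exp_L2_AE[of k d \<xi>] by eventually_elim simp

lemma point_value_exp_L2:
  assumes "d > 0" "s \<in> {-d..0}"
  shows "point_value d (k *\<^sub>R exp_L2 d \<xi>) s = k * exp (\<xi> * s)"
proof (rule point_value_eqI[OF assms(1) _ _ assms(2)])
  show "continuous_on {-d..0} (\<lambda>s. k * exp (\<xi> * s))" by (intro continuous_intros)
  show "AE t in lborel. t \<in> {-d..0} \<longrightarrow> k * exp (\<xi> * t) = rep_L2 (k *\<^sub>R exp_L2 d \<xi>) t"
    using rep_exp_L2_AE[of k d \<xi>] by eventually_elim simp
qed

lemma set_integral_rep_exp_L2:
  assumes "continuous_on UNIV \<phi>"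
  shows "(LINT s:{-d..0}|lborel. rep_L2 (k *\<^sub>R exp_L2 d \<xi>) s * \<phi> s) =
    k * (LINT s:{-d..0}|lborel. exp (\<xi> * s) * \<phi> s)"
proof -
  have [measurable]: "\<phi> \<in> borel_measurable borel"
    using assms by (rule borel_measurable_continuous_onI)
  have [measurable]: "rep_L2 f \<in> borel_measurable borel" for f
    using sq_integrable_rep[of f] by (simp add: sq_integrable_def)
  have "(LINT s:{-d..0}|lborel. rep_L2 (k *\<^sub>R exp_L2 d \<xi>) s * \<phi> s) =
      (LINT s:{-d..0}|lborel. k * (exp (\<xi> * s) * \<phi> s))"
    unfolding set_lebesgue_integral_def
  proof (rule integral_cong_AE)
    show "AE s in lborel. indicator {-d..0} s *\<^sub>R (rep_L2 (k *\<^sub>R exp_L2 d \<xi>) s * \<phi> s) =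
        indicator {-d..0} s *\<^sub>R (k * (exp (\<xi> * s) * \<phi> s))"
      using rep_exp_L2_AE[of k d \<xi>] by eventually_elim (auto simp: indicator_def)
  qed measurable
  then show ?thesis by simp
qed

text \<open>Integration by parts: the derivative of exp(\<xi> s) \<phi>(s) integrates to zero, since
  the support of \<phi> stays away from both endpoints.\<close>

lemma weak_deriv_exp_L2:
  assumes d: "d > 0"
  shows "weak_deriv d (k *\<^sub>R exp_L2 d \<xi>) ((k * \<xi>) *\<^sub>R exp_L2 d \<xi>)"
  unfolding weak_deriv_def
proof (intro allI impI)
  fix \<phi> \<phi>' assume t: "test_function d \<phi> \<phi>'"
  have c: "continuous_on UNIV \<phi>" "continuous_on UNIV \<phi>'"
    using test_function_continuous[OF t] t by (auto simp: test_function_def)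
  have der: "(\<phi> has_real_derivative \<phi>' s) (at s)" for s
    using t by (simp add: test_function_def)
  have end0: "\<phi> (-d) = 0" "\<phi> 0 = 0"
    using t by (auto simp: test_function_def)
  have "(LINT s|lborel. (\<xi> * (exp (\<xi> * s) * \<phi> s) + exp (\<xi> * s) * \<phi>' s) * indicator {-d..0} s) =
      exp (\<xi> * 0) * \<phi> 0 - exp (\<xi> * (-d)) * \<phi> (-d)"
  proof (rule integral_FTC_Icc_real)
    show "-d \<le> 0" using d by simp
    show "((\<lambda>s. exp (\<xi> * s) * \<phi> s) has_real_derivative
        \<xi> * (exp (\<xi> * s) * \<phi> s) + exp (\<xi> * s) * \<phi>' s) (at s)" for s
      by (rule derivative_eq_intros der refl | simp)+
    show "isCont (\<lambda>s. \<xi> * (exp (\<xi> * s) * \<phi> s) + exp (\<xi> * s) * \<phi>' s) s" for s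
      using c by (intro continuous_intros) (auto simp: continuous_on_eq_continuous_at)
  qed
  then have "(LINT s:{-d..0}|lborel. \<xi> * (exp (\<xi> * s) * \<phi> s) + exp (\<xi> * s) * \<phi>' s) = 0"
    by (simp add: set_lebesgue_integral_def end0 mult.commute)
  moreover have "(LINT s:{-d..0}|lborel. \<xi> * (exp (\<xi> * s) * \<phi> s) + exp (\<xi> * s) * \<phi>' s) =
      (LINT s:{-d..0}|lborel. \<xi> * (exp (\<xi> * s) * \<phi> s)) + (LINT s:{-d..0}|lborel. exp (\<xi> * s) * \<phi>' s)"
    by (intro set_integral_add borel_integrable_atLeastAtMost' continuous_intros
        continuous_on_subset[OF c(1)] continuous_on_subset[OF c(2)]) auto
  ultimately have "(LINT s:{-d..0}|lborel. exp (\<xi> * s) * \<phi>' s) =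
      - (\<xi> * (LINT s:{-d..0}|lborel. exp (\<xi> * s) * \<phi> s))"
    by simp
  then show "(LINT s:{-d..0}|lborel. rep_L2 (k *\<^sub>R exp_L2 d \<xi>) s * \<phi>' s) =
      - (LINT s:{-d..0}|lborel. rep_L2 ((k * \<xi>) *\<^sub>R exp_L2 d \<xi>) s * \<phi> s)"
    using c by (simp add: set_integral_rep_exp_L2)
qed

lemma dds_exp_L2: "d > 0 \<Longrightarrow> dds d (k *\<^sub>R exp_L2 d \<xi>) = (k * \<xi>) *\<^sub>R exp_L2 d \<xi>"
  by (intro dds_eqI exp_L2_on weak_deriv_exp_L2)

definition Gam_vec :: "real \<Rightarrow> real \<Rightarrow> real \<times> L2" where
  "Gam_vec d \<xi> = (1, exp_L2 d \<xi>)"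

lemma Gam_vec_scaleR_X: "k *\<^sub>R Gam_vec d \<xi> \<in> X d"
  by (simp add: Gam_vec_def X_def exp_L2_on)

lemma Gam_eq_inner: "Gam d \<xi> x = inner (Gam_vec d \<xi>) x"
proof -
  have [measurable]: "rep_L2 f \<in> borel_measurable borel" for f
    using sq_integrable_rep[of f] by (simp add: sq_integrable_def)
  have "(LINT t|lborel. rep_L2 (exp_L2 d \<xi>) t * rep_L2 (snd x) t) =
      (LINT t:{-d..0}|lborel. exp (\<xi> * t) * rep_L2 (snd x) t)"
    unfolding set_lebesgue_integral_def
  proof (rule integral_cong_AE)
    show "AE t in lborel. rep_L2 (exp_L2 d \<xi>) t * rep_L2 (snd x) t =
        indicator {-d..0} t *\<^sub>R (exp (\<xi> * t) * rep_L2 (snd x) t)"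
      using rep_exp_L2_AE[of 1 d \<xi>] by eventually_elim simp
  qed measurable
  then show ?thesis by (simp add: Gam_def Gam_vec_def inner_prod_def inner_L2_rep)
qed

text \<open>The coupling condition of the domain holds because the first component \<open>k\<close>
  is the value of k exp(\<xi> s) at \<open>s = 0\<close>.\<close>

lemma Gam_vec_scaleR_D_Astar: "d > 0 \<Longrightarrow> k *\<^sub>R Gam_vec d \<xi> \<in> D_Astar d"
  using weak_deriv_exp_L2[of d k \<xi>] exp_L2_on[of k d \<xi>] exp_L2_on[of "k * \<xi>" d \<xi>]
    point_value_exp_L2[of d 0 k \<xi>]
  by (auto simp: D_Astar_def W12_def X_def Gam_vec_def)

lemma Astar_Gam_vec: "d > 0 \<Longrightarrow> Astar d (k *\<^sub>R Gam_vec d \<xi>) = (0, (k * \<xi>) *\<^sub>R exp_L2 d \<xi>)"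
  by (simp add: Astar_def Gam_vec_def dds_exp_L2)

text \<open>\<open>Astar\<close> erases the first component, so only the integral part of
  \<open>Gam\<close> survives, scaled by \<open>k * \<xi>\<close>.\<close>

lemma inner_Astar_Gam_vec:
  "d > 0 \<Longrightarrow> inner x (Astar d (k *\<^sub>R Gam_vec d \<xi>)) = k * \<xi> * (Gam d \<xi> x - fst x)"
  unfolding Astar_Gam_vec by (simp add: Gam_eq_inner Gam_vec_def inner_prod_def inner_commute)

lemma dirac_md_Gam_vec: "d > 0 \<Longrightarrow> dirac_md d (k *\<^sub>R Gam_vec d \<xi>) = k * exp (- \<xi> * d)"
  by (simp add: dirac_md_def Gam_vec_def point_value_exp_L2)

text \<open>All gradients lie on one line, so this homogeneity turns continuity in the graph norm
  into continuity of a scalar factor.\<close>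

lemma graph_norm_Gam_vec:
  "d > 0 \<Longrightarrow> graph_norm d (k *\<^sub>R Gam_vec d \<xi>) =
     \<bar>k\<bar> * (norm (Gam_vec d \<xi>) + \<bar>\<xi>\<bar> * norm (exp_L2 d \<xi>))"
  by (simp add: graph_norm_def Astar_Gam_vec norm_Pair abs_mult distrib_left)

section \<open>The characteristic root\<close>

lemma xi_props:
  assumes "At > 0" "d > 0"
  shows "xi At d > 0" "xi At d = At * exp (- xi At d * d)"
proof -
  \<comment> \<open>The difference of the two sides is \<open>- At\<close> at 0 and nonnegative at
    \<open>At\<close>, since the exponential is at most 1 there.\<close>
  have "\<exists>z\<ge>0. z \<le> At \<and> z - At * exp (- z * d) = 0"
    using assms by (intro IVT) (auto intro!: continuous_intros)
  then obtain z where z: "z \<ge> 0" "z = At * exp (- z * d)" by auto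
  then have "z > 0" using assms by (metis exp_gt_zero mult_pos_pos)
  \<comment> \<open>Two distinct roots are contradictory: the right-hand side decreases strictly, so
    the larger root would be the smaller one.\<close>
  have dec: "w < u" if "u < w" "u = At * exp (- u * d)" "w = At * exp (- w * d)" for u w
  proof -
    have "At * exp (- w * d) < At * exp (- u * d)"
      using that(1) assms by simp
    then show ?thesis unfolding that(2)[symmetric] that(3)[symmetric] .
  qed
  have xz: "xi At d = z"
    unfolding xi_def
  proof (rule the_equality)
    show "z > 0 \<and> z = At * exp (- z * d)" using \<open>z > 0\<close> z(2) by blast
    fix y assume y: "y > 0 \<and> y = At * exp (- y * d)"
    show "y = z"
    proof (rule ccontr)
      assume "y \<noteq> z"
      then consider "y < z" | "z < y" by linarith
      then show False
        using dec[of y z, OF _ conjunct2[OF y] z(2)] dec[of z y, OF _ z(2) conjunct2[OF y]]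
        by cases (auto dest: less_asym simp del: mult_minus_left)
    qed
  qed
  show "xi At d > 0" unfolding xz by fact
  show "xi At d = At * exp (- xi At d * d)" unfolding xz by (rule z(2))
qed

section \<open>Concave utility and the Hamiltonian\<close>

text \<open>A concave function lies below its tangent at \<open>m\<close>. The argument is run for
  the negated function, whose derivative -c^(-\<sigma>) increases whether \<sigma> is below or above
  1.\<close>

lemma crra_le_tangent:
  fixes c m \<sigma> :: real
  assumes "c > 0" "m > 0" "\<sigma> > 0" "\<sigma> \<noteq> 1"
  shows "c powr (1 - \<sigma>) / (1 - \<sigma>) \<le> m powr (1 - \<sigma>) / (1 - \<sigma>) + m powr (-\<sigma>) * (c - m)"
proof -
  let ?F = "\<lambda>c. - (c powr (1 - \<sigma>) / (1 - \<sigma>))"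
  have der: "(?F has_real_derivative - (c powr (-\<sigma>))) (at c)" if "c > 0" for c
    using that assms by (auto intro!: derivative_eq_intros)
  have "convex_on {0<..} ?F"
  proof (rule convex_on_realI[where f' = "\<lambda>c. - (c powr (-\<sigma>))"])
    show "- (x powr - \<sigma>) \<le> - (y powr - \<sigma>)" if "x \<in> {0<..}" "x \<le> y" for x y
      using that assms by (simp add: powr_mono2')
  qed (auto intro: der)
  then have "?F c - ?F m \<ge> - (m powr (-\<sigma>)) * (c - m)"
    using assms
    by (intro convex_on_imp_above_tangent[where A = "{0<..}"])
      (auto simp: interior_open intro: has_field_derivative_at_within der)
  then show ?thesis by simp
qed

lemma utility_le:
  fixes c m \<sigma> :: real
  assumes "c \<ge> 0" "m > 0" "\<sigma> > 0" "\<sigma> \<noteq> 1"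
  shows "utility \<sigma> c \<le> ereal (m powr (1 - \<sigma>) / (1 - \<sigma>) + m powr (-\<sigma>) * (c - m))"
proof (cases "c = 0")
  case True
  have "m powr (1 - \<sigma>) = m powr (-\<sigma>) * m"
    using assms powr_add[of m "-\<sigma>" 1] by (simp add: add.commute)
  \<comment> \<open>At zero consumption the tangent takes a value with the sign of 1-\<sigma>. For
    \<sigma> < 1 it is nonnegative while the utility is 0; for \<sigma> > 1 the utility is minus
    infinity.\<close>
  then have "m powr (1 - \<sigma>) / (1 - \<sigma>) + m powr (-\<sigma>) * (c - m) = m powr (1 - \<sigma>) * (\<sigma> / (1 - \<sigma>))"
    using assms True by (simp add: field_simps)
  then show ?thesis using assms True by (auto simp: utility_def)
next
  case False
  then show ?thesis using crra_le_tangent[of c m \<sigma>] assms by (simp add: utility_def)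
qed

lemma SUP_utility:
  fixes a b m \<sigma> :: real
  assumes m: "0 < m" "m \<le> b - a" and \<sigma>: "\<sigma> > 0" "\<sigma> \<noteq> 1"
  shows "(SUP u\<in>{a..b}. ereal (u * m powr (-\<sigma>)) + utility \<sigma> (b - u)) =
    ereal (b * m powr (-\<sigma>) + \<sigma> / (1 - \<sigma>) * m powr (1 - \<sigma>))"
proof -
  have pm: "m powr (1 - \<sigma>) = m * m powr (-\<sigma>)"
    using m powr_add[of m 1 "-\<sigma>"] by simp
  \<comment> \<open>As a function of \<open>u\<close> the tangent has slope
    \<open>- (m powr (-\<sigma>))\<close>, which cancels the linear term, so the upper bound is the
    same for all controls.\<close>
  have val: "u * m powr (-\<sigma>) + (m powr (1 - \<sigma>) / (1 - \<sigma>) + m powr (-\<sigma>) * ((b - u) - m)) =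
      b * m powr (-\<sigma>) + \<sigma> / (1 - \<sigma>) * m powr (1 - \<sigma>)" for u
    unfolding pm using \<sigma> by (simp add: field_simps)
  show ?thesis
  proof (rule antisym)
    show "(SUP u\<in>{a..b}. ereal (u * m powr (-\<sigma>)) + utility \<sigma> (b - u)) \<le>
        ereal (b * m powr (-\<sigma>) + \<sigma> / (1 - \<sigma>) * m powr (1 - \<sigma>))"
    proof (rule SUP_least)
      fix u assume "u \<in> {a..b}"
      then have "ereal (u * m powr (-\<sigma>)) + utility \<sigma> (b - u) \<le> ereal (u * m powr (-\<sigma>)) +
          ereal (m powr (1 - \<sigma>) / (1 - \<sigma>) + m powr (-\<sigma>) * ((b - u) - m))"
        using m \<sigma> by (intro add_left_mono utility_le) auto
      then show "ereal (u * m powr (-\<sigma>)) + utility \<sigma> (b - u) \<le>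
          ereal (b * m powr (-\<sigma>) + \<sigma> / (1 - \<sigma>) * m powr (1 - \<sigma>))"
        unfolding plus_ereal.simps val .
    qed
    have "ereal ((b - m) * m powr (-\<sigma>)) + utility \<sigma> (b - (b - m)) \<le>
        (SUP u\<in>{a..b}. ereal (u * m powr (-\<sigma>)) + utility \<sigma> (b - u))"
      using m by (intro SUP_upper) auto
    moreover have "ereal ((b - m) * m powr (-\<sigma>)) + utility \<sigma> (b - (b - m)) =
        ereal (b * m powr (-\<sigma>) + \<sigma> / (1 - \<sigma>) * m powr (1 - \<sigma>))"
      using m val[of "b - m"] by (simp add: utility_def)
    ultimately show "ereal (b * m powr (-\<sigma>) + \<sigma> / (1 - \<sigma>) * m powr (1 - \<sigma>)) \<le>
        (SUP u\<in>{a..b}. ereal (u * m powr (-\<sigma>)) + utility \<sigma> (b - u))" by simp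
  qed
qed

section \<open>The value function and the equation\<close>

lemma has_derivative_crra_Gam:
  fixes \<nu> :: real
  assumes \<sigma>: "\<sigma> \<noteq> 1" and x: "x \<in> Q_set d \<xi>"
    and v: "\<And>x. x \<in> Q_set d \<xi> \<Longrightarrow> v x = \<nu> * (Gam d \<xi> x powr (1 - \<sigma>) / (1 - \<sigma>))"
  shows "(v has_derivative (\<lambda>h. inner ((\<nu> * Gam d \<xi> x powr (-\<sigma>)) *\<^sub>R Gam_vec d \<xi>) h)) (at x within X d)"
proof -
  let ?g = "Gam_vec d \<xi>"
  let ?w = "\<lambda>y. \<nu> * (inner ?g y powr (1 - \<sigma>) / (1 - \<sigma>))"
  have pos: "inner ?g x > 0" and xX: "x \<in> X d" using x by (auto simp: Q_set_def Gam_eq_inner)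
  have "((\<lambda>r. \<nu> * (r powr (1 - \<sigma>) / (1 - \<sigma>))) has_real_derivative \<nu> * inner ?g x powr (-\<sigma>))
      (at (inner ?g x))"
    using pos \<sigma> by (auto intro!: derivative_eq_intros)
  then have "((\<lambda>r. \<nu> * (r powr (1 - \<sigma>) / (1 - \<sigma>))) has_derivative
      (\<lambda>h. \<nu> * inner ?g x powr (-\<sigma>) * h)) (at (inner ?g x))"
    by (simp add: has_field_derivative_def)
  moreover have "((\<lambda>y. inner ?g y) has_derivative (\<lambda>h. inner ?g h)) (at x within X d)"
    by (auto intro!: derivative_eq_intros)
  ultimately have w: "(?w has_derivative (\<lambda>h. \<nu> * inner ?g x powr (-\<sigma>) * inner ?g h)) (at x within X d)"
    by (rule has_derivative_compose[rotated])
  \<comment> \<open>\<open>v\<close> is prescribed only on \<open>Q_set d \<xi>\<close>; since this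
    set is relatively open in \<open>X d\<close>, the formula holds near \<open>x\<close> and
    determines the derivative.\<close>
  have "open {y. inner ?g y > 0}" by (intro open_Collect_less continuous_intros)
  then have "\<forall>\<^sub>F y in at x within X d. y \<in> {y. inner ?g y > 0}"
    using pos by (intro eventually_at_topological[THEN iffD2]) auto
  moreover have "\<forall>\<^sub>F y in at x within X d. y \<in> X d"
    by (auto simp: eventually_at_filter)
  ultimately have "\<forall>\<^sub>F y in at x within X d. ?w y = v y"
    by eventually_elim (simp add: v Q_set_def Gam_eq_inner)
  then have "(v has_derivative (\<lambda>h. \<nu> * inner ?g x powr (-\<sigma>) * inner ?g h)) (at x within X d)"
    using x xX by (intro has_derivative_transform_eventually[OF w]) (auto simp: v Gam_eq_inner)
  then show ?thesis by (simp add: Gam_eq_inner)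
qed

theorem proposition5p21:
  fixes A \<delta> At d \<rho> \<sigma> \<xi> \<alpha> \<nu> :: real and v :: "real \<times> L2 \<Rightarrow> real"
  assumes "A > 0" and "\<delta> \<ge> 0" and "At = A - \<delta>" and "At > 0"
    and "d > 0" and "\<rho> > 0" and "\<sigma> > 0" and "\<sigma> \<noteq> 1"
    and "\<xi> = xi At d"
    and "\<rho> > \<xi> * (1 - \<sigma>)"
    and "\<alpha> = (\<rho> - \<xi> * (1 - \<sigma>)) / (\<sigma> * \<xi>)"
    and "\<nu> = \<alpha> powr (-\<sigma>) * (1 / \<xi>)"
    and "\<And>x. x \<in> Q_set d \<xi> \<Longrightarrow> v x = \<nu> * (Gam d \<xi> x powr (1 - \<sigma>) / (1 - \<sigma>))"
  shows "(\<forall>x\<in>Q_set d \<xi>. v differentiable (at x within X d)) \<and>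
         classical_solution A At d \<rho> \<sigma> (O_set A At d \<xi> \<alpha>) v"
proof -
  have \<xi>: "\<xi> > 0" "At * exp (- \<xi> * d) = \<xi>"
    using xi_props[of At d] assms by auto
  have \<alpha>: "\<alpha> > 0" using assms \<xi> by simp
  let ?g = "Gam_vec d \<xi>"
  let ?O = "O_set A At d \<xi> \<alpha>"
  define k where "k x = \<nu> * Gam d \<xi> x powr (-\<sigma>)" for x
  note der = has_derivative_crra_Gam[OF \<open>\<sigma> \<noteq> 1\<close> _ assms(13), folded k_def]
  have grad: "gradient d v x = k x *\<^sub>R ?g" if "x \<in> Q_set d \<xi>" for x
    using that der[OF that] by (intro gradient_eqI Gam_vec_scaleR_X) (auto simp: Q_set_def)
  have OQ: "?O \<subseteq> Q_set d \<xi>" by (auto simp: O_set_def)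
  have gradO: "gradient d v x = k x *\<^sub>R ?g" if "x \<in> ?O" for x
    using OQ that by (intro grad) auto
  have k: "continuous_on ?O k"
    unfolding k_def Gam_eq_inner
    by (intro continuous_intros) (auto simp: O_set_def Q_set_def Gam_eq_inner)
  have diff: "v differentiable (at x within X d)" if "x \<in> Q_set d \<xi>" for x
    using der[OF that] by (auto simp: differentiable_def)
  have "openin (top_of_set (X d)) ?O"
  proof -
    have "open ({x. 0 < inner ?g x} \<inter> {x. inner ?g x < fst x * (A / (\<alpha> * At))})"
      by (intro open_Int open_Collect_less continuous_intros)
    moreover have "?O = X d \<inter> ({x. 0 < inner ?g x} \<inter> {x. inner ?g x < fst x * (A / (\<alpha> * At))})"
      by (auto simp: O_set_def Q_set_def Gam_eq_inner)
    ultimately show ?thesis by (auto simp: openin_open)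
  qed
  moreover have "continuous_on ?O (gradient d v)"
    using k by (subst continuous_on_cong[OF refl gradO]) (auto intro!: continuous_intros)
  moreover have "((\<lambda>y. graph_norm d (gradient d v y - gradient d v x)) \<longlongrightarrow> 0) (at x within ?O)"
    if x: "x \<in> ?O" for x
  proof -
    let ?C = "norm ?g + \<bar>\<xi>\<bar> * norm (exp_L2 d \<xi>)"
    have "(k \<longlongrightarrow> k x) (at x within ?O)" using k x by (simp add: continuous_on_def)
    then have "((\<lambda>y. \<bar>k y - k x\<bar> * ?C) \<longlongrightarrow> \<bar>k x - k x\<bar> * ?C) (at x within ?O)"
      by (intro tendsto_intros)
    moreover have "\<forall>\<^sub>F y in at x within ?O.
        \<bar>k y - k x\<bar> * ?C = graph_norm d (gradient d v y - gradient d v x)"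
      using x \<open>d > 0\<close>
      by (auto simp: eventually_at_filter gradO graph_norm_Gam_vec scaleR_left_diff_distrib[symmetric])
    ultimately show ?thesis by (auto intro: Lim_transform_eventually)
  qed
  moreover have "HJB_at A At d \<rho> \<sigma> v x" if x: "x \<in> ?O" for x
  proof -
    let ?G = "Gam d \<xi> x"
    let ?m = "\<alpha> * ?G"
    have G: "?G > 0" and Gx: "?G < fst x * (A / (\<alpha> * At))" using x by (auto simp: O_set_def Q_set_def)
    have m: "?m > 0" using \<alpha> G by simp
    \<comment> \<open>The right-hand side equals \<open>fst x * (A / At)\<close>, so this is the
      inequality defining \<open>O_set\<close>, multiplied by \<alpha>.\<close>
    have mx: "?m \<le> fst x - (1 - A / At) * fst x"
      using Gx \<alpha> \<open>At > 0\<close> by (simp add: field_simps)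
    \<comment> \<open>The factor 1/\<xi> in \<nu> cancels \<xi>, and \<alpha>^(-\<sigma>) merges
      with the power of \<open>Gam\<close>.\<close>
    have kx: "k x * \<xi> = ?m powr (-\<sigma>)"
      using \<alpha> G \<xi> by (simp add: k_def assms(12) powr_mult)
    have "u * At * dirac_md d (gradient d v x) = u * ?m powr (-\<sigma>)" for u
    proof -
      have "u * At * dirac_md d (gradient d v x) = u * (k x * (At * exp (- \<xi> * d)))"
        using \<open>d > 0\<close> x by (simp add: gradO dirac_md_Gam_vec mult_ac)
      then show ?thesis by (simp only: \<xi>(2) kx)
    qed
    then have sup: "(SUP u\<in>{(1 - A / At) * fst x .. fst x}.
          ereal (u * At * dirac_md d (gradient d v x)) + utility \<sigma> (fst x - u)) =
        ereal (fst x * ?m powr (-\<sigma>) + \<sigma> / (1 - \<sigma>) * ?m powr (1 - \<sigma>))"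
      using SUP_utility[OF m mx \<open>\<sigma> > 0\<close> \<open>\<sigma> \<noteq> 1\<close>] by (simp only:)
    have inn: "inner x (Astar d (gradient d v x)) = ?m powr (-\<sigma>) * (?G - fst x)"
      using \<open>d > 0\<close> x kx by (simp add: gradO inner_Astar_Gam_vec)
    have vx: "v x = ?m powr (-\<sigma>) * ?G / (\<xi> * (1 - \<sigma>))"
    proof -
      have "?G powr (1 - \<sigma>) = ?G powr (-\<sigma>) * ?G"
        using G powr_add[of ?G "-\<sigma>" 1] by (simp add: add.commute)
      then show ?thesis
        using assms(13)[of x] x OQ \<alpha> G by (auto simp: assms(12) powr_mult)
    qed
    have pm: "?m powr (1 - \<sigma>) = ?m powr (-\<sigma>) * ?m"
      using m powr_add[of ?m "-\<sigma>" 1] by (simp add: add.commute)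
    have \<rho>: "\<rho> = \<xi> * (1 - \<sigma> + \<sigma> * \<alpha>)"
      using \<xi> \<open>\<sigma> > 0\<close> by (simp add: assms(11) field_simps)
    \<comment> \<open>Once the power is abstracted, what remains is a rational identity, within
      reach of \<open>field_simps\<close>.\<close>
    define P where "P = ?m powr (-\<sigma>)"
    have "\<rho> * v x = (1 - \<sigma> + \<sigma> * \<alpha>) * P * ?G / (1 - \<sigma>)"
      using \<xi> by (simp add: vx \<rho> P_def)
    also have "\<dots> = P * (?G - fst x) + (fst x * P + \<sigma> / (1 - \<sigma>) * (P * ?m))"
      using \<open>\<sigma> \<noteq> 1\<close> by (simp add: field_simps)
    finally show ?thesis
      unfolding HJB_at_def sup inn pm P_def by simp
  qed
  ultimately show ?thesis
    unfolding classical_solution_def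
    using diff OQ gradO Gam_vec_scaleR_D_Astar[OF \<open>d > 0\<close>] by auto
qed

end
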